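(* Let $n\ge 1$ and $\boldsymbol{s}=(s_1,\ldots,s_n)\in\mathbb{Z}_{\geq 1}^n$. Then the $\boldsymbol{s}$-lecture hall polytope $\mathbf{P}_n^{(\boldsymbol{s})}$ is Gorenstein if and only if there exists $\boldsymbol{c}=(c_1,\ldots,c_{n+1})\in\mathbb{Z}^{n+1}$ satisfying $c_1=1$, $$c_j s_{j-1}=c_{j-1}s_j+\gcd(s_{j-1},s_j)\quad\text{for all } 1<j\leq n,$$ and $$c_{n+1}s_n=1+c_n.$$
   Context: For $\boldsymbol{s}=(s_1,\ldots,s_n)\in\mathbb{Z}_{\ge1}^n$, the $\boldsymbol{s}$-lecture hall polytope is $$\mathbf{P}_n^{(\boldsymbol{s})}=\left\{\boldsymbol{\lambda}\in\mathbb{R}^n : 0\leq\frac{\lambda_1}{s_1}\leq\frac{\lambda_2}{s_2}\leq\cdots\leq\frac{\lambda_n}{s_n}\leq 1\right\}.$$ It is a lattice simplex. For a lattice polytope $P\subset\mathbb{R}^n$ with vertex set $V(P)$, $\mathrm{cone}(P)=\mathrm{span}_{\mathbb{R}_{\ge0}}\{(\boldsymbol{v},1):\boldsymbol{v}\in V(P)\}\subset\mathbb{R}^{n+1}$, and $\mathrm{cone}(P)^\circ$ denotes its relative interior. $P$ is Gorenstein if its semigroup algebra $k[\mathrm{cone}(P)\cap\mathbb{Z}^{n+1}]$ is Gorenstein ($k$ an algebraically closed field of characteristic zero); equivalently, there exists $\boldsymbol{g}\in\mathbb{Z}^{n+1}$ with $\boldsymbol{g}+(\mathrm{cone}(P)\cap\mathbb{Z}^{n+1})=\mathrm{cone}(P)^\circ\cap\mathbb{Z}^{n+1}$.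 *)

theory Defs
  imports "HOL-Analysis.Analysis"
begin

text \<open>
  Euclidean \<open>n\<close>-space is \<^typ>\<open>real ^ 'n\<close> with \<open>CARD('n) = n\<close>, and \<open>(n+1)\<close>-space is
  \<^typ>\<open>(real ^ 'n) \<times> real\<close>.  As \<open>'n\<close> carries no order, the numbering of the coordinates is
  given by a bijection \<open>e\<close> from \<open>{1..n}\<close> onto \<open>'n\<close>: the \<open>j\<close>-th coordinate of \<open>x\<close> is
  \<open>x $ e j\<close>.
\<close>

definition lecture_hall_polytope ::
    "(nat \<Rightarrow> 'n::finite) \<Rightarrow> (nat \<Rightarrow> nat) \<Rightarrow> (real ^ 'n) set" where
  "lecture_hall_polytope e s =
     {x. 0 \<le> x $ e 1 / real (s 1)
       \<and> (\<forall>j. 1 < j \<and> j \<le> CARD('n) \<longrightarrow>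
              x $ e (j - 1) / real (s (j - 1)) \<le> x $ e j / real (s j))
       \<and> x $ e CARD('n) / real (s CARD('n)) \<le> 1}"

definition vertices :: "'a::real_vector set \<Rightarrow> 'a set" where
  "vertices P = {v. v extreme_point_of P}"

definition lattice_points :: "((real ^ 'n::finite) \<times> real) set" where
  "lattice_points = {(x, t). (\<forall>i. x $ i \<in> \<int>) \<and> t \<in> \<int>}"

definition cone_over :: "(real ^ 'n::finite) set \<Rightarrow> ((real ^ 'n) \<times> real) set" where
  "cone_over P = convex_cone hull ((\<lambda>v. (v, 1)) ` vertices P)"

text \<open>
  \<^term>\<open>convex_cone hull S\<close> is the set of nonnegative linear combinations of \<open>S\<close>:
\<close>

lemma convex_cone_hull_eq_nonneg_span:
  fixes S :: "'a::real_vector set"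
  assumes "finite S"
  shows "convex_cone hull S = {\<Sum>v\<in>S. a v *\<^sub>R v | a. \<forall>v\<in>S. 0 \<le> a v}" (is "_ = ?C")
proof
  have "S \<subseteq> ?C"
  proof
    fix x assume x: "x \<in> S"
    have "(\<Sum>v\<in>S. (if v = x then 1 else 0) *\<^sub>R v) = (\<Sum>v\<in>S. if v = x then v else 0)"
      by (rule sum.cong) auto
    also have "\<dots> = x"
      using assms x by simp
    finally show "x \<in> ?C"
      by (intro CollectI exI[of _ "\<lambda>v. if v = x then 1 else 0"]) auto
  qed
  moreover have "convex_cone ?C"
    unfolding convex_cone_iff
  proof (intro conjI ballI allI impI)
    show "0 \<in> ?C" by (auto intro!: exI[of _ "\<lambda>_. 0"])
  next
    fix x y assume "x \<in> ?C" "y \<in> ?C"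
    then obtain a b where "\<forall>v\<in>S. 0 \<le> a v" "x = (\<Sum>v\<in>S. a v *\<^sub>R v)"
      and "\<forall>v\<in>S. 0 \<le> b v" "y = (\<Sum>v\<in>S. b v *\<^sub>R v)" by auto
    then show "x + y \<in> ?C"
      by (intro CollectI exI[of _ "\<lambda>v. a v + b v"]) (auto simp: scaleR_add_left sum.distrib)
  next
    fix x c assume "x \<in> ?C" "0 \<le> (c::real)"
    then obtain a where "\<forall>v\<in>S. 0 \<le> a v" "x = (\<Sum>v\<in>S. a v *\<^sub>R v)" by auto
    with \<open>0 \<le> c\<close> show "c *\<^sub>R x \<in> ?C"
      by (intro CollectI exI[of _ "\<lambda>v. c * a v"]) (auto simp: scaleR_sum_right)
  qed
  ultimately show "convex_cone hull S \<subseteq> ?C"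
    by (rule hull_minimal)
next
  have cc: "convex_cone (convex_cone hull S)"
    by (rule convex_cone_convex_cone_hull)
  show "?C \<subseteq> convex_cone hull S"
  proof
    fix x assume "x \<in> ?C"
    then obtain a where a: "\<forall>v\<in>S. 0 \<le> a v" and x: "x = (\<Sum>v\<in>S. a v *\<^sub>R v)" by auto
    have "(\<Sum>v\<in>T. a v *\<^sub>R v) \<in> convex_cone hull S" if "T \<subseteq> S" for T
      using finite_subset[OF that assms] that
    proof (induction T rule: finite_induct)
      case empty
      show ?case by (simp add: convex_cone_hull_contains_0)
    next
      case (insert v T)
      then have "a v *\<^sub>R v \<in> convex_cone hull S"
        using a by (intro convex_cone_scaleR[OF cc]) (auto intro: hull_inc)
      with insert show ?case by (simp add: convex_cone_add[OF cc])
    qed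
    with x show "x \<in> convex_cone hull S" by blast
  qed
qed

text \<open>
  For a lattice polytope \<open>P\<close>, the following is the description of the Gorenstein property
  (of the semigroup algebra of the lattice points in the cone over \<open>P\<close>) in terms of the
  semigroup: its interior lattice points are a translate of all its lattice points.
\<close>

definition gorenstein :: "(real ^ 'n::finite) set \<Rightarrow> bool" where
  "gorenstein P \<longleftrightarrow>
     (\<exists>g\<in>lattice_points.
        (\<lambda>x. g + x) ` (cone_over P \<inter> lattice_points) =
        rel_interior (cone_over P) \<inter> lattice_points)"

end

theory Submission imports Defs begin

text \<open>
  With \<open>s\<^sub>0 = s\<^sub>n\<^sub>+\<^sub>1 = 1\<close> and \<open>\<lambda>\<^sub>0 = 0\<close>, the cone over the polytope is cut out by the \<open>n + 1\<close>
  inequalities \<open>s\<^sub>j\<^sub>-\<^sub>1 \<lambda>\<^sub>j - s\<^sub>j \<lambda>\<^sub>j\<^sub>-\<^sub>1 \<ge> 0\<close>, and its interior by the strict ones.  On lattice points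
  the \<open>j\<close>-th functional takes multiples of \<open>d\<^sub>j = gcd(s\<^sub>j\<^sub>-\<^sub>1, s\<^sub>j)\<close>, so it is at least \<open>d\<^sub>j\<close> on interior
  lattice points; moving a Bezout solution far along the \<open>j\<close>-th facet shows that \<open>d\<^sub>j\<close> is attained.
  Hence the interior lattice points are a translate by \<open>g\<close> of all lattice points of the cone iff
  the \<open>j\<close>-th functional equals \<open>d\<^sub>j\<close> at \<open>g\<close> for every \<open>j\<close>, which is the recurrence for \<open>c = g\<close>.
\<close>

section \<open>Cones cut out by linear inequalities, and cones over convex bodies\<close>

text \<open>The strict set is open, hence inside the interior. Conversely, an interior point can
  move a little in direction \<open>- u\<close>, which lowers every \<open>f i\<close> by a positive
  amount, so its own values are positive. The witness \<open>u\<close> makes the interior nonempty,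
  so it is the relative interior.\<close>

lemma rel_interior_linear_ineqs:
  fixes f :: "'i \<Rightarrow> 'a::euclidean_space \<Rightarrow> real"
  assumes lin: "\<And>i. i \<in> I \<Longrightarrow> linear (f i)" and fin: "finite I"
    and u: "\<And>i. i \<in> I \<Longrightarrow> 0 < f i u"
  shows "rel_interior {x. \<forall>i\<in>I. 0 \<le> f i x} = {x. \<forall>i\<in>I. 0 < f i x}" (is "rel_interior ?C = ?U")
proof -
  have "?U = (\<Inter>i\<in>I. {x. 0 < f i x})" by auto
  moreover have "open {x. 0 < f i x}" if "i \<in> I" for i
    using lin[OF that] by (intro open_Collect_less continuous_intros linear_continuous_on)
      (auto simp: linear_conv_bounded_linear)
  ultimately have "open ?U" using fin by auto
  then have sub: "?U \<subseteq> interior ?C" by (intro interior_maximal) (auto intro: less_imp_le)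
  have "interior ?C \<subseteq> ?U"
  proof clarify
    fix x i assume x: "x \<in> interior ?C" and i: "i \<in> I"
    then obtain r where r: "r > 0" "cball x r \<subseteq> ?C" by (auto simp: mem_interior_cball)
    \<comment> \<open>Keeps \<open>x - \<epsilon> *\<^sub>R u\<close> within distance
      \<open>r\<close> of \<open>x\<close>; the \<open>+ 1\<close> covers
      \<open>u = 0\<close>.\<close>
    define \<epsilon> where "\<epsilon> = r / (norm u + 1)"
    have pos: "norm u + 1 > 0" by (simp add: add_nonneg_pos)
    have eps: "\<epsilon> > 0" using r pos by (simp add: \<epsilon>_def)
    have "\<epsilon> * norm u \<le> r" using r pos by (simp add: \<epsilon>_def field_simps)
    then have "x - \<epsilon> *\<^sub>R u \<in> cball x r" using eps by (simp add: dist_norm)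
    then have "0 \<le> f i (x - \<epsilon> *\<^sub>R u)" using r i by blast
    then have "\<epsilon> * f i u \<le> f i x"
      by (simp add: linear_diff[OF lin[OF i]] linear_scale[OF lin[OF i]])
    moreover have "0 < \<epsilon> * f i u" using eps u[OF i] by simp
    ultimately show "0 < f i x" by linarith
  qed
  moreover have "u \<in> ?U" using u by auto
  ultimately show ?thesis using sub rel_interior_nonempty_interior[of ?C] by blast
qed

text \<open>By Krein-Milman \<open>P\<close> is the convex hull of its vertices, and lifting to
  height 1, a linear map followed by a translation, commutes with convex hulls. This avoids
  determining the vertices of the polytope.\<close>

lemma cone_over_compact_convex:
  assumes "compact P" "convex P"
  shows "cone_over P = convex_cone hull ((\<lambda>v. (v, 1)) ` P)"
proof -
  have "(\<lambda>v. (v, 1::real)) ` P = (\<lambda>v. (0, 1) + (v, 0)) ` (convex hull (vertices P))"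
    using Krein_Milman_Minkowski[OF assms] by (simp add: vertices_def)
  also have "\<dots> = (+) (0, 1) ` (\<lambda>v. (v, 0)) ` (convex hull (vertices P))"
    by (simp add: image_image)
  also have "\<dots> = convex hull ((\<lambda>v. (v, 1)) ` vertices P)"
  proof -
    have "linear (\<lambda>v::real^'a. (v, 0::real))" by (intro linearI) auto
    then show ?thesis
      by (simp add: convex_hull_linear_image convex_hull_translation [symmetric] image_image)
  qed
  also have "\<dots> \<subseteq> cone_over P"
    unfolding cone_over_def
    by (intro hull_minimal hull_subset)
      (use convex_cone_convex_cone_hull in \<open>auto simp: convex_cone_def\<close>)
  finally have "convex_cone hull ((\<lambda>v. (v, 1)) ` P) \<subseteq> cone_over P"
    by (intro hull_minimal) (auto simp: cone_over_def convex_cone_convex_cone_hull)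
  moreover have "cone_over P \<subseteq> convex_cone hull ((\<lambda>v. (v, 1)) ` P)"
    unfolding cone_over_def
    by (intro hull_mono image_mono) (auto simp: vertices_def extreme_point_of_def)
  ultimately show ?thesis by blast
qed

section \<open>Facet functionals and their values on lattice points\<close>

locale lecture_hall =
  fixes n :: nat and e :: "nat \<Rightarrow> 'n::finite" and s :: "nat \<Rightarrow> nat"
  assumes card_n: "CARD('n) = n"
    and bij: "bij_betw e {1..n} (UNIV :: 'n set)"
    and s_pos: "\<forall>j\<in>{1..n}. 1 \<le> s j"
begin

definition S :: "nat \<Rightarrow> int" where
  "S j = (if j \<in> {1..n} then int (s j) else 1)"

text \<open>The height serves as coordinate \<open>n + 1\<close>, so the homogenised upper bound has
  the same shape as the other inequalities.\<close>

definition coord :: "(real ^ 'n) \<times> real \<Rightarrow> nat \<Rightarrow> real" where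
  "coord z j = (if j = 0 then 0 else if j \<le> n then fst z $ e j else snd z)"

definition functional :: "nat \<Rightarrow> (real ^ 'n) \<times> real \<Rightarrow> real" where
  "functional j z = of_int (S (j - 1)) * coord z j - of_int (S j) * coord z (j - 1)"

definition d :: "nat \<Rightarrow> int" where
  "d j = gcd (S (j - 1)) (S j)"

text \<open>A right inverse of \<open>coord\<close> on the indices \<open>1\<close> to
  \<open>n + 1\<close>, turning integer sequences into lattice points.\<close>

definition point :: "(nat \<Rightarrow> int) \<Rightarrow> (real ^ 'n) \<times> real" where
  "point v = (\<chi> i. of_int (v (inv_into {1..n} e i)), of_int (v (n + 1)))"

lemma n_pos: "1 \<le> n"
  using card_n by (metis One_nat_def Suc_leI zero_less_card_finite)

lemma S_pos: "S j > 0"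
  using s_pos by (force simp: S_def)

lemma d_pos: "d j > 0"
  using S_pos[of j] by (simp add: d_def)

lemma coord_point: "j \<in> {1..n+1} \<Longrightarrow> coord (point v) j = of_int (v j)"
  using bij_betw_inv_into_left[OF bij, of j]
  by (cases "j = n + 1") (auto simp: coord_def point_def)

lemma coord_0 [simp]: "coord z 0 = 0"
  by (simp add: coord_def)

lemma coord_add: "coord (x + y) j = coord x j + coord y j"
  and coord_scale: "coord (r *\<^sub>R x) j = r * coord x j"
  by (auto simp: coord_def)

lemma linear_functional: "linear (functional j)"
  by (intro linearI) (auto simp: functional_def coord_add coord_scale algebra_simps)

lemma lattice_points_iff: "z \<in> lattice_points \<longleftrightarrow> (\<forall>j\<in>{1..n+1}. coord z j \<in> \<int>)"
proof -
  have "(\<forall>i. fst z $ i \<in> \<int>) \<longleftrightarrow> (\<forall>j\<in>{1..n}. fst z $ e j \<in> \<int>)"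
    using bij by (metis UNIV_I bij_betw_def imageE)
  moreover have "{1..n+1} = insert (n+1) {1..n}" by auto
  then have "(\<forall>j\<in>{1..n+1}. coord z j \<in> \<int>) \<longleftrightarrow> (\<forall>j\<in>{1..n}. coord z j \<in> \<int>) \<and> coord z (n+1) \<in> \<int>"
    by auto
  ultimately show ?thesis
    by (cases z) (auto simp: lattice_points_def coord_def)
qed

lemma point_lattice: "point v \<in> lattice_points"
  by (simp add: lattice_points_iff coord_point del: atLeastAtMost_iff)

lemma functional_point:
  assumes "j \<in> {1..n+1}" "v 0 = 0"
  shows "functional j (point v) = of_int (S (j - 1) * v j - S j * v (j - 1))"
proof (cases "j = 1")
  case True
  then show ?thesis using assms by (simp add: functional_def coord_point)
next
  case False
  then have "j - 1 \<in> {1..n+1}" using assms by auto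
  then show ?thesis using assms by (simp add: functional_def coord_point del: atLeastAtMost_iff)
qed

text \<open>\<open>d j\<close> divides both coefficients of the functional, and the coordinates are
  integers.\<close>

lemma functional_lattice:
  assumes "z \<in> lattice_points" "j \<in> {1..n+1}"
  obtains k where "functional j z = of_int (d j * k)"
proof -
  have *: "coord z i \<in> \<int>" if "i \<le> n + 1" for i
    using assms(1) that by (cases "i = 0") (auto simp: lattice_points_iff)
  obtain a b where ab: "coord z j = of_int a" "coord z (j - 1) = of_int b"
    using *[of j] *[of "j - 1"] assms(2) by (metis Ints_cases atLeastAtMost_iff diff_le_self le_trans)
  have "d j dvd S (j - 1) * a - S j * b" by (auto simp: d_def)
  then obtain k where "S (j - 1) * a - S j * b = d j * k" ..
  then have "functional j z = of_int (d j * k)"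
    using ab by (simp add: functional_def flip: of_int_mult of_int_diff)
  then show ?thesis by (rule that)
qed

lemma d_le_functional:
  assumes "z \<in> lattice_points" "j \<in> {1..n+1}" "0 < functional j z"
  shows "of_int (d j) \<le> functional j z"
proof -
  obtain k where k: "functional j z = of_int (d j * k)" using functional_lattice assms by blast
  then have "0 < k" using assms(3) d_pos[of j] by (simp add: zero_less_mult_iff del: of_int_mult)
  then have "d j * 1 \<le> d j * k" using d_pos[of j] by (intro mult_left_mono) auto
  then show ?thesis using k by (simp del: of_int_mult)
qed

text \<open>The point \<open>w\<close> is the Bezout solution and \<open>y\<close> lies in the relative interior of the \<open>j\<close>-th facet.\<close>

lemma functional_attains_d:
  assumes j: "j \<in> {1..n+1}"
  obtains z where "z \<in> lattice_points" "functional j z = of_int (d j)"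
    "\<forall>i\<in>{1..n+1}. 0 < functional i z"
proof -
  \<comment> \<open>For \<open>j = 1\<close> the entry \<open>b\<close> sits at index 0, where the
    coordinate is fixed to 0; as \<open>S 0 = 1\<close>, the choice \<open>b = 0\<close> is
    possible.\<close>
  have "\<exists>a b. S (j - 1) * a - S j * b = d j \<and> (j = 1 \<longrightarrow> b = 0)"
  proof (cases "j = 1")
    case True
    then show ?thesis by (intro exI[of _ 1] exI[of _ 0]) (simp add: S_def d_def)
  next
    case False
    obtain a b where "a * S (j - 1) + b * S j = d j" using bezout_int d_def by metis
    with False show ?thesis by (intro exI[of _ a] exI[of _ "-b"]) (simp add: algebra_simps)
  qed
  then obtain a b where ab: "S (j - 1) * a - S j * b = d j" "j = 1 \<Longrightarrow> b = 0" by blast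
  define w where "w i = (if i = j then a else if i = j - 1 then b else 0)" for i
  \<comment> \<open>The ratios \<open>y i / S i\<close> run through 0, 1, 2, ... with
    \<open>j - 1\<close> repeated at index \<open>j\<close>, so exactly the \<open>j\<close>-th
    inequality is an equality.\<close>
  define y where "y i = S i * int (if i < j then i else i - 1)" for i
  define F where "F v i = S (i - 1) * v i - S i * v (i - 1)" for v and i :: nat
  \<comment> \<open>\<open>N\<close> exceeds every \<open>\<bar>F w i\<bar>\<close>, and
    \<open>F y i \<ge> 1\<close> off \<open>j\<close>, so \<open>N * y\<close> outweighs
    \<open>w\<close> there; at \<open>j\<close> it contributes 0 and leaves
    \<open>d j\<close>.\<close>
  define N where "N = 1 + (\<Sum>i=1..n+1. \<bar>F w i\<bar>)"
  define v where "v i = w i + N * y i" for i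
  have v0: "v 0 = 0" using j ab(2) by (auto simp: v_def w_def y_def)
  have Fv: "F v i = F w i + N * F y i" for i
    by (simp add: F_def v_def algebra_simps)
  have Fw: "F w j = d j" using ab j by (auto simp: F_def w_def)
  have Fy: "F y i = (if i = j then 0 else S (i - 1) * S i)" if "i \<in> {1..n+1}" for i
    using that j by (auto simp: F_def y_def algebra_simps of_nat_diff)
  have Fvj: "F v j = d j" using Fv Fw Fy j by simp
  have "F v i > 0" if i: "i \<in> {1..n+1}" for i
  proof (cases "i = j")
    case True
    then show ?thesis using Fvj d_pos by simp
  next
    case False
    have "\<bar>F w i\<bar> \<le> (\<Sum>i=1..n+1. \<bar>F w i\<bar>)" using i by (intro member_le_sum) auto
    then have N: "\<bar>F w i\<bar> < N" by (simp add: N_def)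
    have "0 < S (i - 1) * S i" using S_pos by simp
    then have "N * 1 \<le> N * (S (i - 1) * S i)" using N by (intro mult_left_mono) auto
    then show ?thesis using Fv[of i] Fy[OF i] False N by simp
  qed
  then show ?thesis
    using that[of "point v"] point_lattice functional_point[of _ v] v0 j Fvj
    by (auto simp: F_def simp flip: of_int_mult of_int_diff)
qed

section \<open>Inequalities for the polytope, the cone and its interior\<close>

lemma functional_nonneg_iff:
  "0 \<le> functional j z \<longleftrightarrow> coord z (j - 1) / of_int (S (j - 1)) \<le> coord z j / of_int (S j)"
  using S_pos[of j] S_pos[of "j - 1"] by (simp add: functional_def field_simps)

lemma polytope_iff:
  "x \<in> lecture_hall_polytope e s \<longleftrightarrow> (\<forall>j\<in>{1..n+1}. 0 \<le> functional j (x, 1))"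
proof -
  have split: "(\<forall>j\<in>{1..n+1}. Q j) \<longleftrightarrow> Q 1 \<and> (\<forall>j. 1 < j \<and> j \<le> n \<longrightarrow> Q j) \<and> Q (n + 1)" for Q
  proof (intro iffI ballI)
    fix j assume "Q 1 \<and> (\<forall>j. 1 < j \<and> j \<le> n \<longrightarrow> Q j) \<and> Q (n + 1)" "j \<in> {1..n+1}"
    then show "Q j" by (cases "j = 1"; cases "j = n + 1") auto
  qed auto
  show ?thesis
    unfolding split functional_nonneg_iff lecture_hall_polytope_def card_n
    using n_pos by (auto simp: coord_def S_def)
qed

text \<open>The ratios \<open>coord z j / S j\<close> increase weakly from 0 at index 0 to the
  height at index \<open>n + 1\<close>. This bounds the polytope and leaves only the origin at
  height 0 of the cone.\<close>

lemma coord_ratio_bounds: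
  assumes "\<forall>j\<in>{1..n+1}. 0 \<le> functional j z" "j \<le> n + 1"
  shows "0 \<le> coord z j / of_int (S j)" "coord z j / of_int (S j) \<le> snd z"
proof -
  have mono: "coord z i / of_int (S i) \<le> coord z k / of_int (S k)" if "i \<le> k" "k \<le> n + 1" for i k
    using that
  proof (induction k rule: dec_induct)
    case (step m)
    then have "0 \<le> functional (Suc m) z" using assms(1) by simp
    then show ?case using step by (simp add: functional_nonneg_iff)
  qed simp
  show "0 \<le> coord z j / of_int (S j)" using mono[of 0 j] assms(2) by simp
  show "coord z j / of_int (S j) \<le> snd z"
    using mono[of j "n + 1"] assms(2) by (simp add: coord_def[of z "Suc n"] S_def[of "Suc n"])
qed

lemma coord_bounds:
  assumes "\<forall>j\<in>{1..n+1}. 0 \<le> functional j z" "j \<le> n + 1"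
  shows "0 \<le> coord z j" "coord z j \<le> of_int (S j) * snd z"
  using coord_ratio_bounds[OF assms] S_pos[of j] by (simp_all add: field_simps)

lemma compact_polytope: "compact (lecture_hall_polytope e s)"
proof -
  have "lecture_hall_polytope e s \<subseteq> cbox 0 (\<chi> i. of_int (S (inv_into {1..n} e i)))"
  proof
    fix x assume x: "x \<in> lecture_hall_polytope e s"
    have "0 \<le> x $ i \<and> x $ i \<le> of_int (S (inv_into {1..n} e i))" for i
    proof -
      obtain j where j: "j \<in> {1..n}" "e j = i"
        using bij by (metis UNIV_I bij_betw_def imageE)
      then have "inv_into {1..n} e i = j" using bij_betw_inv_into_left[OF bij] by blast
      then show ?thesis
        using coord_bounds[of "(x, 1)" j] j x by (auto simp: polytope_iff coord_def)
    qed
    then show "x \<in> cbox 0 (\<chi> i. of_int (S (inv_into {1..n} e i)))" by (simp add: mem_box_cart)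
  qed
  then have "bounded (lecture_hall_polytope e s)" by (rule bounded_subset[OF bounded_cbox])
  moreover have "closed (lecture_hall_polytope e s)"
    unfolding lecture_hall_polytope_def divide_inverse
    by (intro closed_Collect_conj closed_Collect_all closed_Collect_imp closed_Collect_le
        continuous_intros open_Collect_const)
  ultimately show ?thesis by (simp add: compact_eq_bounded_closed)
qed

lemma convex_cone_functionals: "convex_cone {z. \<forall>j\<in>{1..n+1}. 0 \<le> functional j z}"
  by (auto simp: convex_cone_iff linear_add[OF linear_functional] linear_scale[OF linear_functional]
      linear_0[OF linear_functional])

lemma convex_polytope: "convex (lecture_hall_polytope e s)"
proof -
  have "lecture_hall_polytope e s = (\<lambda>x. (x, 1)) -` {z. \<forall>j\<in>{1..n+1}. 0 \<le> functional j z}"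
    by (auto simp: polytope_iff)
  moreover have "convex \<dots>"
  proof (rule convexI)
    fix x y :: "real ^ 'n" and u v :: real
    let ?A = "{z. \<forall>j\<in>{1..n+1}. 0 \<le> functional j z}"
    assume h: "x \<in> (\<lambda>x. (x, 1)) -` ?A" "y \<in> (\<lambda>x. (x, 1)) -` ?A" "0 \<le> u" "0 \<le> v" "u + v = 1"
    then have "u *\<^sub>R (x, 1) + v *\<^sub>R (y, 1) \<in> ?A"
      using convexD[of ?A "(x, 1)" "(y, 1)" u v] convex_cone_functionals
      by (auto simp: convex_cone_def)
    then show "u *\<^sub>R x + v *\<^sub>R y \<in> (\<lambda>x. (x, 1)) -` ?A" using h(5) by simp
  qed
  ultimately show ?thesis by simp
qed

text \<open>A solution of positive height rescales to height 1, where it is a point of the polytope;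
  at height 0 the coordinate bounds force it to be 0.\<close>

lemma cone_over_polytope:
  "cone_over (lecture_hall_polytope e s) = {z. \<forall>j\<in>{1..n+1}. 0 \<le> functional j z}" (is "_ = ?C")
proof -
  let ?P = "lecture_hall_polytope e s"
  have eq: "cone_over ?P = convex_cone hull ((\<lambda>v. (v, 1)) ` ?P)"
    by (rule cone_over_compact_convex[OF compact_polytope convex_polytope])
  also have "\<dots> = ?C"
  proof
    show "convex_cone hull ((\<lambda>v. (v, 1)) ` ?P) \<subseteq> ?C"
      by (intro hull_minimal convex_cone_functionals) (auto simp: polytope_iff)
    show "?C \<subseteq> convex_cone hull ((\<lambda>v. (v, 1)) ` ?P)"
    proof
      fix z assume z: "z \<in> ?C"
      then have bounds: "0 \<le> coord z j" "coord z j \<le> of_int (S j) * snd z" if "j \<le> n + 1" for j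
        using coord_bounds[of z j] that by auto
      show "z \<in> convex_cone hull ((\<lambda>v. (v, 1)) ` ?P)"
      proof (cases "snd z = 0")
        case True
        have "fst z $ i = 0" for i
        proof -
          obtain j where "j \<in> {1..n}" "e j = i" using bij by (metis UNIV_I bij_betw_def imageE)
          then show ?thesis using bounds[of j] True by (simp add: coord_def)
        qed
        then have "z = 0" using True by (auto simp: prod_eq_iff vec_eq_iff)
        then show ?thesis by (simp add: convex_cone_hull_contains_0)
      next
        case False
        have t: "snd z > 0" using bounds[of "n + 1"] False by (simp add: coord_def)
        define x where "x = fst z /\<^sub>R snd z"
        have zx: "z = snd z *\<^sub>R (x, 1)" using False by (simp add: x_def prod_eq_iff)
        have "0 \<le> functional j (x, 1)" if "j \<in> {1..n+1}" for j
        proof -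
          have "0 \<le> functional j (snd z *\<^sub>R (x, 1))" using z that zx by auto
          then show ?thesis
            unfolding linear_scale[OF linear_functional] using t by (simp add: zero_le_mult_iff)
        qed
        then have "(x, 1) \<in> convex_cone hull ((\<lambda>v. (v, 1)) ` ?P)"
          by (intro hull_inc) (auto simp: polytope_iff)
        then show ?thesis
          by (subst zx) (intro convex_cone_scaleR[OF convex_cone_convex_cone_hull], use t in auto)
      qed
    qed
  qed
  finally show ?thesis .
qed

lemma rel_interior_cone_over_polytope:
  "rel_interior (cone_over (lecture_hall_polytope e s)) = {z. \<forall>j\<in>{1..n+1}. 0 < functional j z}"
proof -
  \<comment> \<open>Any index serves here: the resulting point satisfies all the inequalities
    strictly.\<close>
  have "n + 1 \<in> {1..n+1}" by simp
  then obtain u where "\<forall>i\<in>{1..n+1}. 0 < functional i u" by (rule functional_attains_d)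
  then show ?thesis
    unfolding cone_over_polytope by (intro rel_interior_linear_ineqs linear_functional) auto
qed

section \<open>From the Gorenstein translate to the recurrence\<close>

lemma gorenstein_iff_functional:
  "gorenstein (lecture_hall_polytope e s) \<longleftrightarrow>
    (\<exists>g\<in>lattice_points. \<forall>j\<in>{1..n+1}. functional j g = of_int (d j))"
proof -
  let ?C = "{z. \<forall>j\<in>{1..n+1}. 0 \<le> functional j z}"
  let ?U = "{z. \<forall>j\<in>{1..n+1}. 0 < functional j z}"
  have "(+) g ` (?C \<inter> lattice_points) = ?U \<inter> lattice_points \<longleftrightarrow>
      (\<forall>j\<in>{1..n+1}. functional j g = of_int (d j))" (is "?L \<longleftrightarrow> ?R")
    if g: "g \<in> lattice_points" for g
  proof
    assume L: ?L
    show ?R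
    proof
      fix j assume j: "j \<in> {1..n+1}"
      \<comment> \<open>Translating the origin shows that \<open>g\<close> itself is interior,
        whence the lower bound \<open>d j\<close>.\<close>
      have "0 \<in> ?C \<inter> lattice_points"
        by (simp add: linear_0[OF linear_functional] lattice_points_iff coord_def)
      then have "g + 0 \<in> ?U" using L by blast
      then have 1: "of_int (d j) \<le> functional j g" using d_le_functional[OF g j] j by simp
      \<comment> \<open>An interior lattice point with the least value \<open>d j\<close> is
        \<open>g\<close> plus a cone point, which gives the upper bound.\<close>
      obtain z where z: "z \<in> lattice_points" "functional j z = of_int (d j)" "z \<in> ?U"
        using functional_attains_d[OF j] by blast
      then obtain x where x: "z = g + x" "x \<in> ?C" using L by blast
      then have "functional j z = functional j g + functional j x" "0 \<le> functional j x"
        using j by (auto simp: linear_add[OF linear_functional])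
      then show "functional j g = of_int (d j)" using 1 z(2) by linarith
    qed
  next
    assume R: ?R
    show ?L
    proof (intro subset_antisym subsetI)
      fix y assume "y \<in> (+) g ` (?C \<inter> lattice_points)"
      then obtain x where x: "x \<in> ?C" "x \<in> lattice_points" "y = g + x" by blast
      have "0 < functional j y" if "j \<in> {1..n+1}" for j
      proof -
        have "functional j g > 0" using R that d_pos[of j] by simp
        moreover have "functional j x \<ge> 0" using x(1) that by blast
        ultimately show ?thesis by (simp add: x(3) linear_add[OF linear_functional])
      qed
      moreover have "y \<in> lattice_points"
        using g x by (auto simp: lattice_points_iff coord_add)
      ultimately show "y \<in> ?U \<inter> lattice_points" by blast
    next
      fix y assume y: "y \<in> ?U \<inter> lattice_points"
      \<comment> \<open>\<open>functional j y\<close> is at least \<open>d j\<close>, which is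
        exactly what subtracting \<open>g\<close> removes.\<close>
      have "0 \<le> functional j (y - g)" if "j \<in> {1..n+1}" for j
        using d_le_functional[of y j] y R that by (auto simp: linear_diff[OF linear_functional])
      moreover have "y - g \<in> lattice_points"
        using g y by (auto simp: lattice_points_def)
      ultimately show "y \<in> (+) g ` (?C \<inter> lattice_points)"
        by (intro image_eqI[of _ _ "y - g"]) auto
    qed
  qed
  then show ?thesis
    unfolding gorenstein_def rel_interior_cone_over_polytope unfolding cone_over_polytope by blast
qed

lemma functional_eq_d_iff:
  "(\<exists>g\<in>lattice_points. \<forall>j\<in>{1..n+1}. functional j g = of_int (d j)) \<longleftrightarrow>
    (\<exists>c. c 0 = 0 \<and> (\<forall>j\<in>{1..n+1}. S (j - 1) * c j - S j * c (j - 1) = d j))"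
    (is "?L \<longleftrightarrow> ?R")
proof
  assume ?L
  then obtain g where g: "g \<in> lattice_points" "\<forall>j\<in>{1..n+1}. functional j g = of_int (d j)" by blast
  \<comment> \<open>The coordinates up to \<open>n + 1\<close> are already integers; the floor only
    changes their type.\<close>
  define c where "c j = \<lfloor>coord g j\<rfloor>" for j
  have c: "coord g j = of_int (c j)" if "j \<le> n + 1" for j
    using g(1) that unfolding c_def
    by (cases "j = 0") (auto simp: lattice_points_iff of_int_floor)
  have "S (j - 1) * c j - S j * c (j - 1) = d j" if "j \<in> {1..n+1}" for j
  proof -
    have "j \<le> n + 1" "j - 1 \<le> n + 1" using that by auto
    then have "(of_int (S (j - 1) * c j - S j * c (j - 1)) :: real) = of_int (d j)"
      using bspec[OF g(2) that] c[of j] c[of "j - 1"] by (simp add: functional_def)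
    then show ?thesis by (simp only: of_int_eq_iff)
  qed
  then show ?R by (intro exI[of _ c]) (simp add: c_def)
next
  assume ?R
  then obtain c where "c 0 = 0" "\<forall>j\<in>{1..n+1}. S (j - 1) * c j - S j * c (j - 1) = d j" by blast
  then show ?L
    by (intro bexI[of _ "point c"] point_lattice) (simp add: functional_point del: atLeastAtMost_iff)
qed

text \<open>With \<open>c 0 = 0\<close> and \<open>S 0 = S (n + 1) = 1\<close>, index 1 reads
  \<open>c 1 = 1\<close> and index \<open>n + 1\<close> is the closing equation, since both gcds are
  1.\<close>

lemma recurrence_iff:
  "(\<exists>c. c 0 = 0 \<and> (\<forall>j\<in>{1..n+1}. S (j - 1) * c j - S j * c (j - 1) = d j)) \<longleftrightarrow>
    (\<exists>c :: nat \<Rightarrow> int.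
        c 1 = 1
      \<and> (\<forall>j. 1 < j \<and> j \<le> n \<longrightarrow>
             c j * int (s (j - 1)) = c (j - 1) * int (s j) + int (gcd (s (j - 1)) (s j)))
      \<and> c (n + 1) * int (s n) = 1 + c n)" (is "?L \<longleftrightarrow> ?R")
proof
  assume ?L
  then obtain c where c0: "c 0 = 0"
    and c: "\<And>j. j \<in> {1..n+1} \<Longrightarrow> S (j - 1) * c j - S j * c (j - 1) = d j" by blast
  have "c 1 = 1" using c[of 1] c0 by (simp add: S_def d_def)
  moreover have "c j * int (s (j - 1)) = c (j - 1) * int (s j) + int (gcd (s (j - 1)) (s j))"
    if "1 < j" "j \<le> n" for j
  proof -
    have "S (j - 1) = int (s (j - 1))" "S j = int (s j)" using that by (auto simp: S_def)
    then show ?thesis using c[of j] that by (simp add: d_def algebra_simps)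
  qed
  moreover have "c (n + 1) * int (s n) = 1 + c n"
    using c[of "n + 1"] n_pos by (simp add: S_def d_def algebra_simps)
  ultimately show ?R by blast
next
  assume ?R
  then obtain c :: "nat \<Rightarrow> int" where c1: "c 1 = 1"
    and c: "\<And>j. 1 < j \<Longrightarrow> j \<le> n \<Longrightarrow>
      c j * int (s (j - 1)) = c (j - 1) * int (s j) + int (gcd (s (j - 1)) (s j))"
    and cn: "c (n + 1) * int (s n) = 1 + c n" by blast
  \<comment> \<open>The recurrence involves only indices from 1 on, so resetting \<open>c 0\<close>
    preserves it.\<close>
  let ?c = "c(0 := 0)"
  have "S (j - 1) * ?c j - S j * ?c (j - 1) = d j" if j: "j \<in> {1..n+1}" for j
  proof -
    consider "j = 1" | "1 < j" "j \<le> n" | "j = n + 1" using j by force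
    then show ?thesis
    proof cases
      case 1
      then show ?thesis using c1 by (simp add: S_def d_def)
    next
      case 2
      then have "S (j - 1) = int (s (j - 1))" "S j = int (s j)" by (auto simp: S_def)
      then show ?thesis using 2 c[of j] by (simp add: d_def algebra_simps)
    next
      case 3
      then show ?thesis using cn n_pos by (simp add: S_def d_def algebra_simps)
    qed
  qed
  then show ?L by (intro exI[of _ ?c]) simp
qed

end

theorem theorem1:
  fixes n :: nat and e :: "nat \<Rightarrow> 'n::finite" and s :: "nat \<Rightarrow> nat"
  assumes "CARD('n) = n"
    and "bij_betw e {1..n} (UNIV :: 'n set)"
    and "\<forall>j\<in>{1..n}. 1 \<le> s j"
  shows "gorenstein (lecture_hall_polytope e s) \<longleftrightarrow>
    (\<exists>c :: nat \<Rightarrow> int.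
        c 1 = 1
      \<and> (\<forall>j. 1 < j \<and> j \<le> n \<longrightarrow>
             c j * int (s (j - 1)) = c (j - 1) * int (s j) + int (gcd (s (j - 1)) (s j)))
      \<and> c (n + 1) * int (s n) = 1 + c n)"
proof -
  interpret lecture_hall n e s using assms by unfold_locales
  show ?thesis
    using gorenstein_iff_functional functional_eq_d_iff recurrence_iff by simp
qed

end
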